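(* Let $x(0)\in\mathbb{R}^n$, $\overline{u}\in[0,1]$, $B\ge 0$, and let $$U=\Big\{u\in\mathbb{R}^n:\ u_i\in[0,\overline{u}]\ \ \forall i\in V,\ \ \sum_{i=1}^n u_i\le B\Big\},\qquad \Gamma=\{\gamma\in\mathbb{R}^n:\ \gamma_i\in[\underline{\gamma}_i,\overline{\gamma}_i]\ \ \forall i\in V\}.$$ For a target $d\in\{0,1\}$ and $u\in U$, let the controlled initial state be $x_u(0)=d\,u+\mathrm{diag}(x(0))(\mathbf{1}-u)$, and let $x_u(k)$ evolve by $$x_u(k+1)=(I-\mathrm{diag}(\gamma(k))L)\,x_u(k),\qquad \gamma(k)\in\Gamma\ \ \forall k\ge 0 .$$ Let $\alpha_{\min}=\alpha_{\min}(u)$ and $\alpha_{\max}=\alpha_{\max}(u)$ be the lower and upper consensus bounds associated with the initial state $x_u(0)$ (defined in the context), and define $$J(u,\gamma,d)=\frac{\nu^T\mathrm{diag}(1/\gamma)}{\nu^T\mathrm{diag}(1/\gamma)\mathbf{1}}\big(d\,u+\mathrm{diag}(x(0))(\mathbf{1}-u)\big).$$ Assume that the trajectories $x_u(k)$ satisfy the projection condition stated in the context. Then the solutions $u$ to the problem $\max_{u\in U}\alpha_{\min}(u)$ for $d=1$, and to the problem $\min_{u\in U}\alpha_{\max}(u)$ for $d=0$, are given by solving, respectively, $$d=1:\quad \max_{u\in U}\Big(\min_{\gamma\in\Gamma}J(u,\gamma,1)\Big),\qquad\qquad d=0:\quad \min_{u\in U}\Big(\max_{\gamma\in\Gamma}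J(u,\gamma,0)\Big).$$
   Context: Setting: $V=\{1,\dots,n\}$, $n\ge 2$, is a set of agents interacting over a directed graph with weighted adjacency matrix $(a_{ij})$, $a_{ij}\in[0,1]$, $a_{ii}=0$. The graph is assumed strongly connected. $L$ is its Laplacian: $l_{ij}=-a_{ij}$ for $i\ne j$ and $l_{ii}=\sum_{j\ne i}a_{ij}$; by strong connectivity $0$ is a simple eigenvalue of $L$. $\nu\in\mathbb{R}^n$ is the unique vector with $\nu^TL=\mathbf{0}^T$ and $\nu^T\mathbf{1}=1$. For $i\in V$, $n_i$ is the number of $j\in V$ with $a_{ij}\neq 0$. Constants $0<\underline{\omega}\le\overline{\omega}\le 1$ are given, and $\underline{\gamma}_i=\underline{\omega}/n_i$, $\overline{\gamma}_i=\overline{\omega}/n_i$. Notation: $I$ is the identity matrix, $\mathbf{1}$ the column vector of ones, $\mathrm{diag}(\phi)$ the diagonal matrix with diagonal entries $\phi_i$, and $1/\gamma$ the vector with entries $1/\gamma_i$. Consensus bounds for an initial state $y\in\mathbb{R}^n$: let $\gamma_*$ and $\gamma^*$ be a minimizer and a maximizer over $\gamma\in\Gamma$ of $\gamma\mapsto\frac{\nu^T\mathrm{diag}(1/\gamma)\,y}{\nu^T\mathrm{diag}(1/\gamma)\mathbf{1}}$, and set $\underline{\nu}^T=\frac{\nu^T\mathrm{diag}(1/\gamma_* )}{\nu^T\mathrm{diag}(1/\gamma_* )\mathbf{1}}$, $\overline{\nu}^T=\frac{\nu^T\mathrm{diag}(1/\gamma^* )}{\nu^T\mathrm{diag}(1/\gamma^*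 )\mathbf{1}}$. The lower and upper consensus bounds are $\alpha_{\min}=\underline{\nu}^Ty$ and $\alpha_{\max}=\overline{\nu}^Ty$. In the theorem they are taken with $y=x_u(0)$. Projection condition for a trajectory $y(k)$ of $y(k+1)=(I-\mathrm{diag}(\gamma(k))L)y(k)$ with $y(0)=y$: for all $k\ge 0$, $\underline{\nu}^T\mathrm{diag}(\gamma(k))L\,y(k)\le 0$ and $\overline{\nu}^T\mathrm{diag}(\gamma(k))L\,y(k)\ge 0$. (Under this condition $\alpha_{\min}$ and $\alpha_{\max}$ are lower and upper bounds for the consensus value, i.e. for the common limit of the components $y_i(k)$.) *)

theory Defs
  imports
    "HOL-Analysis.Analysis"
    "Graph_Theory.Digraph_Component"
    "Graph_Theory.Pair_Digraph"
begin

text \<open>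
  The agents are the elements of a finite type \<open>'n\<close>, and \<open>\<nu>\<^sup>T M\<close> is written \<open>\<nu> v* M\<close>.
  Arcs are oriented from \<open>i\<close> to \<open>j\<close> when \<open>a\<^sub>i\<^sub>j \<noteq> 0\<close>; the opposite orientation yields the same
  strongly connected graphs.
\<close>

definition interaction_graph :: "real^'n^'n \<Rightarrow> 'n pair_pre_digraph" where
  "interaction_graph A = \<lparr> pverts = UNIV, parcs = {(i, j). A $ i $ j \<noteq> 0} \<rparr>"

definition laplacian :: "real^'n^'n \<Rightarrow> real^'n^'n" where
  "laplacian A = (\<chi> i j. if i = j then (\<Sum>k\<in>UNIV - {i}. A $ i $ k) else - (A $ i $ j))"

definition diag :: "real^'n \<Rightarrow> real^'n^'n" where
  "diag \<phi> = (\<chi> i j. if i = j then \<phi> $ i else 0)"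

definition recip :: "real^'n \<Rightarrow> real^'n" where
  "recip \<gamma> = (\<chi> i. 1 / \<gamma> $ i)"

definition num_neighbors :: "real^'n^'n \<Rightarrow> 'n \<Rightarrow> nat" where
  "num_neighbors A i = card {j. A $ i $ j \<noteq> 0}"

definition Gamma_set :: "real^'n^'n \<Rightarrow> real \<Rightarrow> real \<Rightarrow> (real^'n) set" where
  "Gamma_set A \<omega>l \<omega>u =
     {\<gamma>. \<forall>i. \<gamma> $ i \<in> {\<omega>l / real (num_neighbors A i) .. \<omega>u / real (num_neighbors A i)}}"

definition control_set :: "real \<Rightarrow> real \<Rightarrow> (real^'n) set" where
  "control_set ubar B = {u. (\<forall>i. u $ i \<in> {0..ubar}) \<and> (\<Sum>i\<in>UNIV. u $ i) \<le> B}"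

definition controlled_state :: "real^'n \<Rightarrow> real \<Rightarrow> real^'n \<Rightarrow> real^'n" where
  "controlled_state x0 d u = d *\<^sub>R u + diag x0 *v (1 - u)"

definition consensus_ratio :: "real^'n \<Rightarrow> real^'n \<Rightarrow> real^'n \<Rightarrow> real" where
  "consensus_ratio \<nu> y \<gamma> =
     ((\<nu> v* diag (recip \<gamma>)) \<bullet> y) / ((\<nu> v* diag (recip \<gamma>)) \<bullet> 1)"

definition weight_vector :: "real^'n \<Rightarrow> real^'n \<Rightarrow> real^'n" where
  "weight_vector \<nu> \<gamma> =
     (1 / ((\<nu> v* diag (recip \<gamma>)) \<bullet> 1)) *\<^sub>R (\<nu> v* diag (recip \<gamma>))"

text \<open>
  \<open>arg_min\<close> and \<open>arg_max\<close> select one minimizer \<open>\<gamma>\<^sub>*\<close> and one maximizer \<open>\<gamma>\<^sup>*\<close> whenever these exist.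
\<close>

definition nu_lower :: "real^'n \<Rightarrow> (real^'n) set \<Rightarrow> real^'n \<Rightarrow> real^'n" where
  "nu_lower \<nu> \<Gamma> y = weight_vector \<nu> (arg_min (consensus_ratio \<nu> y) (\<lambda>\<gamma>. \<gamma> \<in> \<Gamma>))"

definition nu_upper :: "real^'n \<Rightarrow> (real^'n) set \<Rightarrow> real^'n \<Rightarrow> real^'n" where
  "nu_upper \<nu> \<Gamma> y = weight_vector \<nu> (arg_max (consensus_ratio \<nu> y) (\<lambda>\<gamma>. \<gamma> \<in> \<Gamma>))"

definition alpha_min :: "real^'n \<Rightarrow> (real^'n) set \<Rightarrow> real^'n \<Rightarrow> real" where
  "alpha_min \<nu> \<Gamma> y = nu_lower \<nu> \<Gamma> y \<bullet> y"

definition alpha_max :: "real^'n \<Rightarrow> (real^'n) set \<Rightarrow> real^'n \<Rightarrow> real" where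
  "alpha_max \<nu> \<Gamma> y = nu_upper \<nu> \<Gamma> y \<bullet> y"

definition trajectory ::
  "real^'n^'n \<Rightarrow> (real^'n) set \<Rightarrow> real^'n \<Rightarrow> (nat \<Rightarrow> real^'n) \<Rightarrow> (nat \<Rightarrow> real^'n) \<Rightarrow> bool" where
  "trajectory L \<Gamma> y0 \<gamma> y \<longleftrightarrow>
     y 0 = y0 \<and> (\<forall>k. \<gamma> k \<in> \<Gamma> \<and> y (Suc k) = (mat 1 - diag (\<gamma> k) ** L) *v y k)"

definition projection_condition ::
  "real^'n \<Rightarrow> real^'n^'n \<Rightarrow> (real^'n) set \<Rightarrow> (nat \<Rightarrow> real^'n) \<Rightarrow> (nat \<Rightarrow> real^'n) \<Rightarrow> bool" where
  "projection_condition \<nu> L \<Gamma> \<gamma> y \<longleftrightarrow>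
     (\<forall>k. nu_lower \<nu> \<Gamma> (y 0) \<bullet> ((diag (\<gamma> k) ** L) *v y k) \<le> 0 \<and>
          nu_upper \<nu> \<Gamma> (y 0) \<bullet> ((diag (\<gamma> k) ** L) *v y k) \<ge> 0)"

definition J :: "real^'n \<Rightarrow> real^'n \<Rightarrow> real^'n \<Rightarrow> real^'n \<Rightarrow> real \<Rightarrow> real" where
  "J \<nu> x0 u \<gamma> d = weight_vector \<nu> \<gamma> \<bullet> (d *\<^sub>R u + diag x0 *v (1 - u))"

definition maximizers :: "('a \<Rightarrow> real) \<Rightarrow> 'a set \<Rightarrow> 'a set" where
  "maximizers f S = {u. is_arg_max f (\<lambda>u. u \<in> S) u}"

definition minimizers :: "('a \<Rightarrow> real) \<Rightarrow> 'a set \<Rightarrow> 'a set" where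
  "minimizers f S = {u. is_arg_min f (\<lambda>u. u \<in> S) u}"

end

theory Submission
  imports Defs
begin

text \<open>
  The cost \<open>J(u, \<gamma>, d)\<close> is the consensus ratio of the controlled initial state at \<open>\<gamma>\<close>, so both
  problems have the same objective as soon as the extrema over \<open>\<Gamma>\<close> are attained. Attainment
  follows from compactness once \<open>\<nu>\<^sup>T diag(1/\<gamma>) \<one>\<close> is known to be nonzero, that is, once \<open>\<nu> \<ge> 0\<close>.
  For the latter, \<open>\<nu>\<^sup>T L = 0\<close> implies \<open>\<bar>\<nu>\<bar>\<^sup>T L = 0\<close>, hence \<open>(\<bar>\<nu>\<bar> + \<nu>)\<^sup>T L = 0\<close>; the zeros of a
  nonnegative left null vector of \<open>L\<close> propagate along arcs, so by strong connectivity
  \<open>\<bar>\<nu>\<bar> + \<nu>\<close> has no zeros unless \<open>\<nu> \<le> 0\<close>, which \<open>\<nu>\<^sup>T \<one> = 1\<close> excludes.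
\<close>

section \<open>Strong connectivity and left null vectors of the Laplacian\<close>

lemma arcs_ends_interaction_graph:
  "arcs_ends (with_proj (interaction_graph A)) = {(i, j). A $ i $ j \<noteq> 0}"
  by (auto simp: interaction_graph_def arcs_ends_def arc_to_ends_def)

text \<open>Library reachability is relative to the vertex set, which is \<open>UNIV\<close> here;
  the plain closure gives access to its case and induction rules.\<close>

lemma strongly_connected_rtrancl:
  assumes "strongly_connected (with_proj (interaction_graph A))"
  shows "(i, j) \<in> {(i, j). A $ i $ j \<noteq> 0}\<^sup>*"
proof -
  have "i \<rightarrow>\<^sup>*\<^bsub>with_proj (interaction_graph A)\<^esub> j"
    using assms by (auto simp: strongly_connected_def interaction_graph_def)
  then show ?thesis
    unfolding reachable_def arcs_ends_interaction_graph
    by (rule rtrancl_on_rtranclI)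
qed

text \<open>A path to a second agent must start with an arc leaving \<open>i\<close>. Since division
  by 0 yields 0, this is what makes the lower bounds of \<open>Gamma_set\<close> positive.\<close>

lemma num_neighbors_pos:
  fixes A :: "real^'n^'n"
  assumes "strongly_connected (with_proj (interaction_graph A))" and "CARD('n) \<ge> 2"
  shows "num_neighbors A i > 0"
proof -
  obtain j where "j \<noteq> i"
  proof -
    have "UNIV \<noteq> {i}"
    proof
      assume "UNIV = {i}"
      then have "CARD('n) = card {i}" by simp
      with assms(2) show False by simp
    qed
    with that show thesis by blast
  qed
  with strongly_connected_rtrancl[OF assms(1), of i j] obtain k where "A $ i $ k \<noteq> 0"
    by (auto elim: converse_rtranclE)
  then show ?thesis
    by (auto simp: num_neighbors_def card_gt_0_iff)
qed

text \<open>Entry \<open>j\<close> of the product is a balance between weighted outflow and inflow;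
  the zero diagonal of \<open>A\<close> lets both sums run over all agents.\<close>

lemma laplacian_null_iff:
  assumes "\<And>i. A $ i $ i = 0"
  shows "p v* laplacian A = 0 \<longleftrightarrow>
    (\<forall>j. p $ j * (\<Sum>k\<in>UNIV. A $ j $ k) = (\<Sum>i\<in>UNIV. p $ i * A $ i $ j))"
proof -
  have "(p v* laplacian A) $ j =
      p $ j * (\<Sum>k\<in>UNIV. A $ j $ k) - (\<Sum>i\<in>UNIV. p $ i * A $ i $ j)" for j
  proof -
    have row: "(\<Sum>k\<in>UNIV - {j}. A $ j $ k) = (\<Sum>k\<in>UNIV. A $ j $ k)"
      using assms by (intro sum.mono_neutral_left) auto
    have "(p v* laplacian A) $ j = (\<Sum>i\<in>UNIV. p $ i * laplacian A $ i $ j)"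
      by (simp add: vector_matrix_mult_def)
    also have "\<dots> = (\<Sum>i\<in>UNIV. (if i = j then p $ j * (\<Sum>k\<in>UNIV. A $ j $ k) else 0)
        - p $ i * A $ i $ j)"
      using assms by (intro sum.cong) (auto simp: laplacian_def row)
    finally show ?thesis
      by (simp add: sum_subtractf)
  qed
  then show ?thesis
    by (simp add: vec_eq_iff)
qed

text \<open>The triangle inequality turns each balance into \<open>?l j \<le> ?r j\<close>. Both
  sides have the same total over \<open>j\<close>, as exchanging the sums shows, so every inequality
  is tight.\<close>

lemma laplacian_null_abs:
  assumes "\<And>i. A $ i $ i = 0" and nonneg: "\<And>i j. A $ i $ j \<ge> 0"
    and "p v* laplacian A = 0"
  shows "(\<chi> i. \<bar>p $ i\<bar>) v* laplacian A = 0"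
proof -
  let ?l = "\<lambda>j. \<bar>p $ j\<bar> * (\<Sum>k\<in>UNIV. A $ j $ k)"
  let ?r = "\<lambda>j. \<Sum>i\<in>UNIV. \<bar>p $ i\<bar> * A $ i $ j"
  have le: "?l j \<le> ?r j" for j
  proof -
    have "?l j = \<bar>p $ j * (\<Sum>k\<in>UNIV. A $ j $ k)\<bar>"
      by (simp add: abs_mult sum_nonneg nonneg)
    also have "\<dots> = \<bar>\<Sum>i\<in>UNIV. p $ i * A $ i $ j\<bar>"
      using assms(3) laplacian_null_iff[of A p] assms(1) by simp
    also have "\<dots> \<le> (\<Sum>i\<in>UNIV. \<bar>p $ i * A $ i $ j\<bar>)"
      by (rule sum_abs)
    finally show ?thesis
      by (simp add: abs_mult nonneg)
  qed
  have "(\<Sum>j\<in>UNIV. ?r j) = (\<Sum>j\<in>UNIV. ?l j)"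
    by (subst sum.swap) (simp add: sum_distrib_left)
  then have "(\<Sum>j\<in>UNIV. ?r j - ?l j) = 0"
    by (simp add: sum_subtractf)
  then have "\<forall>j\<in>UNIV. ?r j - ?l j = 0"
    using le by (subst (asm) sum_nonneg_eq_0_iff) auto
  then show ?thesis
    using laplacian_null_iff[of A] assms(1) by simp
qed

text \<open>A zero at \<open>k\<close> makes the inflow at \<open>k\<close>, a sum of nonnegative
  terms, vanish. Zeros therefore spread backwards along arcs, and every agent has a path to
  \<open>j\<close>.\<close>

lemma laplacian_null_nonneg_zero:
  assumes "\<And>i. A $ i $ i = 0" and "\<And>i j. A $ i $ j \<ge> 0"
    and "strongly_connected (with_proj (interaction_graph A))"
    and "p v* laplacian A = 0" and "\<And>i. p $ i \<ge> 0" and "p $ j = 0"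
  shows "p = 0"
proof -
  have pred: "p $ i = 0" if "p $ k = 0" "A $ i $ k \<noteq> 0" for i k
  proof -
    have "(\<Sum>i\<in>UNIV. p $ i * A $ i $ k) = 0"
      using assms(4) laplacian_null_iff[of A p] assms(1) that(1) by (metis mult_zero_left)
    then have "\<forall>i\<in>UNIV. p $ i * A $ i $ k = 0"
      using assms(2,5) by (subst (asm) sum_nonneg_eq_0_iff) auto
    with that(2) show ?thesis by auto
  qed
  have "p $ i = 0" for i
    using strongly_connected_rtrancl[OF assms(3), of i j]
    by (induction rule: converse_rtrancl_induct) (auto simp: assms(6) intro: pred)
  then show ?thesis
    by (simp add: vec_eq_iff)
qed

lemma laplacian_left_eigenvector_nonneg:
  assumes "\<And>i. A $ i $ i = 0" and "\<And>i j. A $ i $ j \<ge> 0"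
    and "strongly_connected (with_proj (interaction_graph A))"
    and "\<nu> v* laplacian A = 0" and "\<nu> \<bullet> 1 = 1"
  shows "\<nu> $ i \<ge> 0"
proof (rule ccontr)
  assume neg: "\<not> \<nu> $ i \<ge> 0"
  \<comment> \<open>The entries of \<open>p\<close> vanish exactly where \<nu> is nonpositive:
    \<open>p\<close> has a zero at \<open>i\<close>, and \<open>p = 0\<close> would make all of
    \<nu> nonpositive.\<close>
  define p where "p = (\<chi> i. \<bar>\<nu> $ i\<bar>) + \<nu>"
  have p_nth: "p $ k = \<bar>\<nu> $ k\<bar> + \<nu> $ k" for k
    by (simp add: p_def)
  have "p v* laplacian A = 0"
    using laplacian_null_abs[OF assms(1,2,4)] assms(4)
    by (simp add: p_def vector_matrix_left_distrib)
  moreover have "p $ k \<ge> 0" for k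
    using abs_ge_minus_self[of "\<nu> $ k"] by (simp add: p_nth)
  moreover have "p $ i = 0"
    using neg by (simp add: p_nth)
  ultimately have "p = 0"
    by (rule laplacian_null_nonneg_zero[OF assms(1-3)])
  then have "\<nu> $ k \<le> 0" for k
    using p_nth[of k] by simp
  then have "\<nu> \<bullet> 1 \<le> 0"
    by (simp add: inner_vec_def sum_nonpos)
  with assms(5) show False by simp
qed

section \<open>The weights as a function of \<gamma>\<close>

lemma vector_matrix_mult_diag: "p v* diag q = (\<chi> i. p $ i * q $ i)"
proof -
  have "(\<Sum>i\<in>UNIV. p $ i * diag q $ i $ j) = p $ j * q $ j" for j
  proof -
    have "(\<Sum>i\<in>UNIV. p $ i * diag q $ i $ j) =
        (\<Sum>i\<in>UNIV. if i = j then p $ j * q $ j else 0)"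
      by (intro sum.cong) (auto simp: diag_def)
    then show ?thesis by simp
  qed
  then show ?thesis
    by (simp add: vec_eq_iff vector_matrix_mult_def)
qed

lemma consensus_ratio_eq_inner: "consensus_ratio \<nu> y \<gamma> = weight_vector \<nu> \<gamma> \<bullet> y"
  by (simp add: consensus_ratio_def weight_vector_def)

lemma J_eq_inner: "J \<nu> x0 u \<gamma> d = weight_vector \<nu> \<gamma> \<bullet> controlled_state x0 d u"
  by (simp add: J_def controlled_state_def)

text \<open>The denominator is a sum of nonnegative terms, and an index \<open>k\<close> with
  \<open>\<nu> $ k \<noteq> 0\<close> contributes a positive one.\<close>

lemma continuous_on_weight_vector:
  assumes "\<And>i. \<nu> $ i \<ge> 0" and "\<nu> \<noteq> 0" and pos: "\<And>\<gamma> i. \<gamma> \<in> S \<Longrightarrow> \<gamma> $ i > 0"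
  shows "continuous_on S (weight_vector \<nu>)"
proof -
  have eq: "weight_vector \<nu> =
      (\<lambda>\<gamma>. (1 / (\<Sum>i\<in>UNIV. \<nu> $ i * (1 / \<gamma> $ i))) *\<^sub>R (\<chi> i. \<nu> $ i * (1 / \<gamma> $ i)))"
    by (rule ext) (simp add: weight_vector_def vector_matrix_mult_diag recip_def inner_vec_def)
  obtain k where k: "\<nu> $ k \<noteq> 0"
    using assms(2) by (auto simp: vec_eq_iff)
  have denom: "(\<Sum>i\<in>UNIV. \<nu> $ i * (1 / \<gamma> $ i)) \<noteq> 0" if "\<gamma> \<in> S" for \<gamma>
  proof -
    have "\<nu> $ k * (1 / \<gamma> $ k) > 0"
      using assms(1)[of k] k pos[OF that, of k] by simp
    then have "(\<Sum>i\<in>UNIV. \<nu> $ i * (1 / \<gamma> $ i)) > 0"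
      using assms(1) pos[OF that] by (intro sum_pos2[of _ k]) (auto simp: less_imp_le)
    then show ?thesis by simp
  qed
  have "\<gamma> $ i \<noteq> 0" if "\<gamma> \<in> S" for \<gamma> i
    using pos[OF that, of i] by simp
  then show ?thesis
    unfolding eq using denom by (intro continuous_intros ballI) auto
qed

section \<open>Compactness of the feasible sets\<close>

lemma Gamma_set_eq_cbox:
  "Gamma_set A \<omega>l \<omega>u =
    cbox (\<chi> i. \<omega>l / real (num_neighbors A i)) (\<chi> i. \<omega>u / real (num_neighbors A i))"
  by (auto simp: Gamma_set_def mem_box_cart)

lemma Gamma_set_nonempty:
  assumes "\<omega>l \<le> \<omega>u"
  shows "Gamma_set A \<omega>l \<omega>u \<noteq> {}"
proof -
  have "(\<chi> i. \<omega>l / real (num_neighbors A i)) \<in> Gamma_set A \<omega>l \<omega>u"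
    using assms by (simp add: Gamma_set_def divide_right_mono)
  then show ?thesis by blast
qed

lemma compact_control_set: "compact (control_set ubar B :: (real^'n) set)"
proof -
  have "(control_set ubar B :: (real^'n) set) =
      cbox 0 (\<chi> i. ubar) \<inter> {u. (\<Sum>i\<in>UNIV. u $ i) \<le> B}"
    by (auto simp: control_set_def mem_box_cart)
  moreover have "closed {u :: real^'n. (\<Sum>i\<in>UNIV. u $ i) \<le> B}"
    by (intro closed_Collect_le continuous_intros)
  ultimately show ?thesis
    by (simp add: compact_Int_closed)
qed

lemma zero_in_control_set: "ubar \<ge> 0 \<Longrightarrow> B \<ge> 0 \<Longrightarrow> 0 \<in> control_set ubar B"
  by (simp add: control_set_def)

lemma continuous_on_controlled_state: "continuous_on S (controlled_state x0 d)"
  unfolding controlled_state_def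
  by (intro continuous_intros
      bounded_linear.continuous_on[OF matrix_vector_mul_bounded_linear])

section \<open>Attained extrema and their dependence on the state\<close>

lemma minimizers_eq: "minimizers f S = {u \<in> S. \<forall>v\<in>S. f u \<le> f v}"
  by (auto simp: minimizers_def is_arg_min_linorder)

lemma maximizers_eq: "maximizers f S = {u \<in> S. \<forall>v\<in>S. f v \<le> f u}"
  by (auto simp: maximizers_def is_arg_max_linorder)

lemma minimizers_nonempty:
  assumes "compact S" and "S \<noteq> {}" and "continuous_on S f"
  shows "minimizers f S \<noteq> {}"
  using continuous_attains_inf[OF assms] by (auto simp: minimizers_eq)

lemma maximizers_nonempty:
  assumes "compact S" and "S \<noteq> {}" and "continuous_on S f"
  shows "maximizers f S \<noteq> {}"
  using continuous_attains_sup[OF assms] by (auto simp: maximizers_eq)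

text \<open>\<open>arg_min\<close> is a Hilbert choice, meaningful once a minimizer exists; the
  value is then the same for every choice.\<close>

lemma arg_min_value_eq_INF:
  assumes "minimizers f S \<noteq> {}"
  shows "f (arg_min f (\<lambda>x. x \<in> S)) = (INF x\<in>S. f x)"
proof -
  have "is_arg_min f (\<lambda>x. x \<in> S) (arg_min f (\<lambda>x. x \<in> S))"
    using assms unfolding minimizers_def arg_min_def by (auto intro: someI)
  then have "(INF x\<in>S. f x) = f (arg_min f (\<lambda>x. x \<in> S))"
    by (intro cInf_eq_minimum) (auto simp: is_arg_min_linorder)
  then show ?thesis by simp
qed

lemma arg_max_value_eq_SUP:
  assumes "maximizers f S \<noteq> {}"
  shows "f (arg_max f (\<lambda>x. x \<in> S)) = (SUP x\<in>S. f x)"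
proof -
  have "is_arg_max f (\<lambda>x. x \<in> S) (arg_max f (\<lambda>x. x \<in> S))"
    using assms unfolding maximizers_def arg_max_def by (auto intro: someI)
  then have "(SUP x\<in>S. f x) = f (arg_max f (\<lambda>x. x \<in> S))"
    by (intro cSup_eq_maximum) (auto simp: is_arg_max_linorder)
  then show ?thesis by simp
qed

text \<open>A supremum of linear functionals of norm at most \<open>C\<close> is
  \<open>C\<close>-Lipschitz. This makes the outer problem over \<open>U\<close> solvable.\<close>

lemma continuous_on_SUP_inner:
  fixes w :: "'b \<Rightarrow> 'a::real_inner"
  assumes "bounded (w ` S)" and "S \<noteq> {}"
  shows "continuous_on T (\<lambda>y. SUP g\<in>S. w g \<bullet> y)"
proof -
  obtain C where C: "C > 0" "\<And>g. g \<in> S \<Longrightarrow> norm (w g) \<le> C"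
    using assms(1) by (auto simp: bounded_pos)
  have bound: "w g \<bullet> y \<le> C * norm y" if "g \<in> S" for g y
    by (rule order_trans[OF norm_cauchy_schwarz]) (simp add: C(2) that mult_right_mono)
  have bdd: "bdd_above ((\<lambda>g. w g \<bullet> y) ` S)" for y
    using bound by (auto intro!: bdd_aboveI)
  \<comment> \<open>One-sided estimate; exchanging \<open>y\<close> and \<open>z\<close> gives the
    other half of the Lipschitz bound.\<close>
  have le: "(SUP g\<in>S. w g \<bullet> y) \<le> (SUP g\<in>S. w g \<bullet> z) + C * norm (y - z)" for y z
  proof (rule cSUP_least[OF assms(2)])
    fix g assume g: "g \<in> S"
    have "w g \<bullet> y = w g \<bullet> z + w g \<bullet> (y - z)"
      by (simp add: inner_diff_right)
    also have "\<dots> \<le> (SUP g\<in>S. w g \<bullet> z) + C * norm (y - z)"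
      by (intro add_mono cSUP_upper[OF g bdd] bound[OF g])
    finally show "w g \<bullet> y \<le> \<dots>" .
  qed
  have "C-lipschitz_on T (\<lambda>y. SUP g\<in>S. w g \<bullet> y)"
  proof (rule lipschitz_onI)
    show "dist (SUP g\<in>S. w g \<bullet> y) (SUP g\<in>S. w g \<bullet> z) \<le> C * dist y z" for y z
      using le[of y z] le[of z y] by (simp add: dist_norm norm_minus_commute)
  qed (use C in simp)
  then show ?thesis
    by (rule lipschitz_on_continuous_on)
qed

text \<open>Reduces to the supremum by negating the functionals.\<close>

lemma continuous_on_INF_inner:
  fixes w :: "'b \<Rightarrow> 'a::real_inner"
  assumes "bounded (w ` S)" and "S \<noteq> {}"
  shows "continuous_on T (\<lambda>y. INF g\<in>S. w g \<bullet> y)"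
proof -
  have "(INF g\<in>S. w g \<bullet> y) = - (SUP g\<in>S. (- w g) \<bullet> y)" for y
    by (simp add: Inf_real_def image_image)
  moreover have "bounded ((\<lambda>g. - w g) ` S)"
    using assms(1) bounded_uminus[of "w ` S"] by (simp add: image_image)
  ultimately show ?thesis
    using continuous_on_SUP_inner[OF _ assms(2), of "\<lambda>g. - w g" T]
    by (auto intro: continuous_on_minus)
qed

text \<open>Having the same solutions is expressed as equality of solution sets. The nonemptiness
  claims make \<open>INF\<close> and \<open>SUP\<close> genuine extrema and keep the equality from
  relating two empty sets.\<close>

theorem theorem2:
  fixes A L :: "real^'n^'n" and \<nu> x0 :: "real^'n"
    and \<omega>l \<omega>u ubar B d :: real
    and \<Gamma> U :: "(real^'n) set"
    and \<gamma> x :: "real^'n \<Rightarrow> nat \<Rightarrow> real^'n"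
  assumes "CARD('n) \<ge> 2"
    and "\<And>i j. A $ i $ j \<in> {0..1}"
    and "\<And>i. A $ i $ i = 0"
    and "strongly_connected (with_proj (interaction_graph A))"
    and "L = laplacian A"
    and "\<nu> v* L = 0" and "\<nu> \<bullet> 1 = 1"
    and "0 < \<omega>l" and "\<omega>l \<le> \<omega>u" and "\<omega>u \<le> 1"
    and "\<Gamma> = Gamma_set A \<omega>l \<omega>u"
    and "ubar \<in> {0..1}" and "B \<ge> 0"
    and "U = control_set ubar B"
    and "d \<in> {0, 1}"
    and "\<And>u. u \<in> U \<Longrightarrow> trajectory L \<Gamma> (controlled_state x0 d u) (\<gamma> u) (x u)"
    and "\<And>u. u \<in> U \<Longrightarrow> projection_condition \<nu> L \<Gamma> (\<gamma> u) (x u)"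
  shows "(d = 1 \<longrightarrow>
            (\<forall>u\<in>U. minimizers (\<lambda>g. J \<nu> x0 u g 1) \<Gamma> \<noteq> {}) \<and>
            maximizers (\<lambda>u. INF g\<in>\<Gamma>. J \<nu> x0 u g 1) U \<noteq> {} \<and>
            maximizers (\<lambda>u. alpha_min \<nu> \<Gamma> (controlled_state x0 1 u)) U
              = maximizers (\<lambda>u. INF g\<in>\<Gamma>. J \<nu> x0 u g 1) U) \<and>
         (d = 0 \<longrightarrow>
            (\<forall>u\<in>U. maximizers (\<lambda>g. J \<nu> x0 u g 0) \<Gamma> \<noteq> {}) \<and>
            minimizers (\<lambda>u. SUP g\<in>\<Gamma>. J \<nu> x0 u g 0) U \<noteq> {} \<and>
            minimizers (\<lambda>u. alpha_max \<nu> \<Gamma> (controlled_state x0 0 u)) U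
              = minimizers (\<lambda>u. SUP g\<in>\<Gamma>. J \<nu> x0 u g 0) U)"
proof -
  have \<Gamma>: "compact \<Gamma>" "\<Gamma> \<noteq> {}"
    using assms(9,11) by (auto simp: Gamma_set_nonempty) (simp add: Gamma_set_eq_cbox)
  have U: "compact U" "U \<noteq> {}"
    using assms(12-14) compact_control_set zero_in_control_set[of ubar B] by auto
  have "\<nu> $ i \<ge> 0" for i
    using assms(2,5,6)
    by (intro laplacian_left_eigenvector_nonneg[OF assms(3) _ assms(4) _ assms(7)]) auto
  moreover have "\<nu> \<noteq> 0"
    using assms(7) by auto
  moreover have "g $ i > 0" if "g \<in> \<Gamma>" for g i
  proof -
    have "\<omega>l / real (num_neighbors A i) > 0"
      using num_neighbors_pos[OF assms(4,1)] assms(8) by simp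
    also have "\<dots> \<le> g $ i"
      using that assms(11) by (simp add: Gamma_set_def)
    finally show ?thesis .
  qed
  ultimately have w: "continuous_on \<Gamma> (weight_vector \<nu>)"
    by (rule continuous_on_weight_vector)
  then have bounded: "bounded (weight_vector \<nu> ` \<Gamma>)"
    using \<Gamma>(1) compact_continuous_image compact_imp_bounded by blast
  have ratio: "continuous_on \<Gamma> (consensus_ratio \<nu> y)" for y
    unfolding consensus_ratio_eq_inner[abs_def] by (intro continuous_intros w)
  have J: "J \<nu> x0 u g e = consensus_ratio \<nu> (controlled_state x0 e u) g" for u g e
    by (simp add: J_eq_inner consensus_ratio_eq_inner)
  have min: "alpha_min \<nu> \<Gamma> y = (INF g\<in>\<Gamma>. consensus_ratio \<nu> y g)" for y
    using arg_min_value_eq_INF[OF minimizers_nonempty[OF \<Gamma> ratio[of y]]]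
    by (simp add: alpha_min_def nu_lower_def consensus_ratio_eq_inner)
  have max: "alpha_max \<nu> \<Gamma> y = (SUP g\<in>\<Gamma>. consensus_ratio \<nu> y g)" for y
    using arg_max_value_eq_SUP[OF maximizers_nonempty[OF \<Gamma> ratio[of y]]]
    by (simp add: alpha_max_def nu_upper_def consensus_ratio_eq_inner)
  \<comment> \<open>The inner optimum is continuous in the state, and the state is affine in
    \<open>u\<close>.\<close>
  have INF: "continuous_on U (\<lambda>u. INF g\<in>\<Gamma>. J \<nu> x0 u g e)" for e
    unfolding J_eq_inner
    by (rule continuous_on_compose2[OF continuous_on_INF_inner[OF bounded \<Gamma>(2), of UNIV]
          continuous_on_controlled_state]) auto
  have SUP: "continuous_on U (\<lambda>u. SUP g\<in>\<Gamma>. J \<nu> x0 u g e)" for e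
    unfolding J_eq_inner
    by (rule continuous_on_compose2[OF continuous_on_SUP_inner[OF bounded \<Gamma>(2), of UNIV]
          continuous_on_controlled_state]) auto
  show ?thesis
    \<comment> \<open>After rewriting with \<open>min\<close>, \<open>max\<close> and
      \<open>J\<close>, the two objectives in each case are the same function of \<open>u\<close>;
      only attainment remains.\<close>
    using minimizers_nonempty[OF \<Gamma> ratio] maximizers_nonempty[OF \<Gamma> ratio]
      maximizers_nonempty[OF U INF] minimizers_nonempty[OF U SUP]
    by (simp add: min max J)
qed

end
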